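(* Let $R=K[x_1,\ldots,x_n]$ be a polynomial ring over a field $K$. Let $I\subset R$ be a monomial ideal and let $I=\mathfrak{I}_1\cap\cdots\cap\mathfrak{I}_r\cap\cdots\cap\mathfrak{I}_m$ be an irredundant minimal primary decomposition of $I$, where $\mathfrak{I}_1,\ldots,\mathfrak{I}_r$ are the primary components associated to the minimal primes of $I$. Then $$I^{(k)}=\mathfrak{I}_1^{k}\cap\cdots\cap\mathfrak{I}_r^{k}\quad\text{for all } k\geq 1.$$
   Context: For an integer $k\geq 1$, the $k$-th symbolic power of $I$ is $I^{(k)}=\bigcap_{i=1}^r(I^kR_{\mathfrak{p}_i}\cap R)$, where $\mathfrak{p}_1,\ldots,\mathfrak{p}_r$ are the minimal primes of $I$. *)

theory Defs
  imports "HOL-Library.Poly_Mapping" "HOL-Algebra.Ideal_Product" "HOL-Algebra.RingHom"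
begin

section \<open>Primary ideals and primary decompositions\<close>

locale primaryideal = ideal + cring +
  assumes I_notcarr: "carrier R \<noteq> I"
    and I_primary: "\<lbrakk>a \<in> carrier R; b \<in> carrier R; a \<otimes> b \<in> I\<rbrakk>
      \<Longrightarrow> a \<in> I \<or> (\<exists>k::nat. b [^] k \<in> I)"

definition radical :: "('a, 'b) ring_scheme \<Rightarrow> 'a set \<Rightarrow> 'a set" where
  "radical R I = {a \<in> carrier R. \<exists>k::nat. a [^]\<^bsub>R\<^esub> k \<in> I}"

definition minimal_primes :: "('a, 'b) ring_scheme \<Rightarrow> 'a set \<Rightarrow> 'a set set" where
  "minimal_primes R I = {P. primeideal P R \<and> I \<subseteq> P \<and>
     (\<forall>P'. primeideal P' R \<and> I \<subseteq> P' \<and> P' \<subseteq> P \<longrightarrow> P' = P)}"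

text \<open>Intersections are taken inside \<^term>\<open>carrier R\<close>, so that the intersection of the
  empty family is the whole ring; the unit ideal thus has the decomposition with no component.\<close>

definition ideal_INT :: "('a, 'b) ring_scheme \<Rightarrow> 'i set \<Rightarrow> ('i \<Rightarrow> 'a set) \<Rightarrow> 'a set" where
  "ideal_INT R A J = carrier R \<inter> (\<Inter>i\<in>A. J i)"

definition minimal_primary_decomposition ::
  "('a, 'b) ring_scheme \<Rightarrow> 'a set \<Rightarrow> (nat \<Rightarrow> 'a set) \<Rightarrow> nat \<Rightarrow> bool" where
  "minimal_primary_decomposition R I Q m \<longleftrightarrow>
     (\<forall>i\<in>{1..m}. primaryideal (Q i) R) \<and>
     I = ideal_INT R {1..m} Q \<and>
     (\<forall>i\<in>{1..m}. \<not> ideal_INT R ({1..m} - {i}) Q \<subseteq> Q i) \<and>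
     inj_on (\<lambda>i. radical R (Q i)) {1..m}"

section \<open>Localization and symbolic powers\<close>

text \<open>The fraction \<open>a / s\<close> is the equivalence class of \<open>(a, s)\<close>.  The operations on
  classes are unions over all representatives, in the style of \<^const>\<open>set_add\<close>; all members
  of such a union coincide.\<close>

definition fraction :: "('a, 'b) ring_scheme \<Rightarrow> 'a set \<Rightarrow> 'a \<Rightarrow> 'a \<Rightarrow> ('a \<times> 'a) set" where
  "fraction R S a s = {(b, t). b \<in> carrier R \<and> t \<in> S \<and>
     (\<exists>u\<in>S. u \<otimes>\<^bsub>R\<^esub> (t \<otimes>\<^bsub>R\<^esub> a) = u \<otimes>\<^bsub>R\<^esub> (s \<otimes>\<^bsub>R\<^esub> b))}"

definition localization :: "('a, 'b) ring_scheme \<Rightarrow> 'a set \<Rightarrow> ('a \<times> 'a) set ring" where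
  "localization R S =
     \<lparr>carrier = {fraction R S a s | a s. a \<in> carrier R \<and> s \<in> S},
      mult = (\<lambda>X Y. \<Union>(a, s)\<in>X. \<Union>(b, t)\<in>Y. fraction R S (a \<otimes>\<^bsub>R\<^esub> b) (s \<otimes>\<^bsub>R\<^esub> t)),
      one = fraction R S \<one>\<^bsub>R\<^esub> \<one>\<^bsub>R\<^esub>,
      zero = fraction R S \<zero>\<^bsub>R\<^esub> \<one>\<^bsub>R\<^esub>,
      add = (\<lambda>X Y. \<Union>(a, s)\<in>X. \<Union>(b, t)\<in>Y.
        fraction R S ((t \<otimes>\<^bsub>R\<^esub> a) \<oplus>\<^bsub>R\<^esub> (s \<otimes>\<^bsub>R\<^esub> b)) (s \<otimes>\<^bsub>R\<^esub> t))\<rparr>"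

abbreviation localization_at :: "('a, 'b) ring_scheme \<Rightarrow> 'a set \<Rightarrow> ('a \<times> 'a) set ring" where
  "localization_at R P \<equiv> localization R (carrier R - P)"

definition to_localization_at :: "('a, 'b) ring_scheme \<Rightarrow> 'a set \<Rightarrow> 'a \<Rightarrow> ('a \<times> 'a) set" where
  "to_localization_at R P a = fraction R (carrier R - P) a \<one>\<^bsub>R\<^esub>"

text \<open>The ideals \<open>J R\<^sub>P\<close> and \<open>J R\<^sub>P \<inter> R\<close>; the latter is the preimage under the
  canonical map \<open>R \<rightarrow> R\<^sub>P\<close>.\<close>

definition extend_at :: "('a, 'b) ring_scheme \<Rightarrow> 'a set \<Rightarrow> 'a set \<Rightarrow> ('a \<times> 'a) set set" where
  "extend_at R P J = Idl\<^bsub>localization_at R P\<^esub> (to_localization_at R P ` J)"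

definition extend_contract_at :: "('a, 'b) ring_scheme \<Rightarrow> 'a set \<Rightarrow> 'a set \<Rightarrow> 'a set" where
  "extend_contract_at R P J = {a \<in> carrier R. to_localization_at R P a \<in> extend_at R P J}"

text \<open>Powers of ideals are powers in the library's monoid of ideals of \<open>R\<close>.\<close>

abbreviation ideal_power :: "('a, 'b) ring_scheme \<Rightarrow> 'a set \<Rightarrow> nat \<Rightarrow> 'a set" where
  "ideal_power R I k \<equiv> I [^]\<^bsub>ideals_set R\<^esub> k"

definition symbolic_power :: "('a, 'b) ring_scheme \<Rightarrow> 'a set \<Rightarrow> nat \<Rightarrow> 'a set" where
  "symbolic_power R I k =
     ideal_INT R (minimal_primes R I) (\<lambda>P. extend_contract_at R P (ideal_power R I k))"

section \<open>Polynomial rings and monomial ideals\<close>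

text \<open>\<open>K[x\<^sub>0, \<dots>, x\<^bsub>n-1\<^esub>]\<close>: polynomials are finitely supported functions from exponent vectors
  to coefficients, and the product is the convolution product of \<^theory>\<open>HOL-Library.Poly_Mapping\<close>.\<close>

definition exponents :: "nat \<Rightarrow> (nat \<Rightarrow>\<^sub>0 nat) set" where
  "exponents n = {e. Poly_Mapping.keys e \<subseteq> {..<n}}"

definition mpoly_ring :: "nat \<Rightarrow> ((nat \<Rightarrow>\<^sub>0 nat) \<Rightarrow>\<^sub>0 'k::field) ring" where
  "mpoly_ring n =
     \<lparr>carrier = {p. Poly_Mapping.keys p \<subseteq> exponents n},
      mult = (*), one = 1, zero = 0, add = (+)\<rparr>"

definition monomial_ideal :: "nat \<Rightarrow> ((nat \<Rightarrow>\<^sub>0 nat) \<Rightarrow>\<^sub>0 'k::field) set \<Rightarrow> bool" where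
  "monomial_ideal n I \<longleftrightarrow>
     (\<exists>E \<subseteq> exponents n. I = Idl\<^bsub>mpoly_ring n\<^esub> ((\<lambda>e. Poly_Mapping.single e 1) ` E))"

end

theory Submission
  imports Defs
begin

text \<open>
  For a prime \<open>P\<close> and an ideal \<open>J\<close>, the contraction \<open>J R\<^sub>P \<inter> R\<close> consists of the \<open>a\<close> with
  \<open>s a \<in> J\<close> for some \<open>s \<notin> P\<close>; it is called \<open>saturation R P J\<close> below.  So \<open>I\<^sup>(\<^sup>k\<^sup>)\<close> is
  the intersection of the saturations of \<open>I\<^sup>k\<close> at the minimal primes of \<open>I\<close>.  In any commutative
  ring with a minimal primary decomposition of \<open>I\<close>, the minimal primes are radicals of components
  (\<open>minimal_prime_is_radical\<close>), and the component belonging to a minimal prime \<open>P\<close> is the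
  saturation of \<open>I\<close> at \<open>P\<close> (\<open>saturation_at_minimal_prime\<close>).  The theorem therefore says that
  saturating a monomial ideal at a minimal prime commutes with taking powers.

  One inclusion, \<open>(sat I)\<^sup>k \<subseteq> sat (I\<^sup>k)\<close>, holds for all ideals: multiply the denominators
  (\<open>power_saturation_subset\<close>).  For the other one, \<open>I \<subseteq> sat I\<close> reduces the claim to the
  statement that \<open>(sat I)\<^sup>k\<close> is already saturated.  This can fail in general, where powers of
  primary ideals need not be primary, and it is here that monomials enter.  A minimal prime of a
  monomial ideal is generated by the variables with index in some set \<open>A\<close>
  (\<open>minimal_prime_of_monomial_ideal\<close>), and setting the variables outside \<open>A\<close> to \<open>1\<close>
  in the generators of \<open>I\<close> gives generators of \<open>sat I\<close>: its members are the combinations of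
  monomials whose exponents lie in a set that depends on the \<open>A\<close>-coordinates only and is closed
  upwards (\<open>saturation_of_monomial_ideal\<close>).  Ideals of that shape are closed under products
  (\<open>ideal_prod_monomial_span\<close>), and they are saturated at \<open>P\<close> because, for a suitable
  monomial order, lowest terms multiply (\<open>monomial_span_cancel\<close>).
\<close>

section \<open>Localization and contraction at a prime\<close>

lemma (in cring) idealI_closed:
  assumes "I \<subseteq> carrier R" and "\<zero> \<in> I"
    and add: "\<And>a b. \<lbrakk>a \<in> I; b \<in> I\<rbrakk> \<Longrightarrow> a \<oplus> b \<in> I"
    and mult: "\<And>a x. \<lbrakk>a \<in> I; x \<in> carrier R\<rbrakk> \<Longrightarrow> x \<otimes> a \<in> I"
  shows "ideal I R"
proof (rule idealI[OF ring_axioms])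
  show "subgroup I (add_monoid R)"
  proof (rule add.subgroupI)
    show "I \<subseteq> carrier R" "I \<noteq> {}" using assms by auto
    show "\<ominus> a \<in> I" if "a \<in> I" for a
      using mult[OF that, of "\<ominus> \<one>"] that assms(1) l_minus[of \<one> a] by auto
    show "a \<oplus> b \<in> I" if "a \<in> I" "b \<in> I" for a b using add that .
  qed
  show "x \<otimes> a \<in> I" if "a \<in> I" "x \<in> carrier R" for a x using mult that .
  show "a \<otimes> x \<in> I" if "a \<in> I" "x \<in> carrier R" for a x
    using mult[OF that] that assms(1) by (metis m_comm subsetD)
qed

text \<open>
  Localization at an arbitrary multiplicative set \<open>S\<close>. That it is a ring has to be known before
  an ideal generated in it can be computed: an intersection of ideals is informative only if
  there are any.
\<close>

locale fractions = cring +
  fixes S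
  assumes S_carrier: "S \<subseteq> carrier R"
    and S_one: "\<one> \<in> S"
    and S_mult: "\<lbrakk>s \<in> S; t \<in> S\<rbrakk> \<Longrightarrow> s \<otimes> t \<in> S"
begin

lemma S_closed [simp]: "s \<in> S \<Longrightarrow> s \<in> carrier R"
  using S_carrier by blast

lemma fraction_eqI:
  assumes "a \<in> carrier R" "b \<in> carrier R" "s \<in> S" "t \<in> S" "u \<in> S"
    and eq: "u \<otimes> (t \<otimes> a) = u \<otimes> (s \<otimes> b)"
  shows "fraction R S a s = fraction R S b t"
proof -
  have *: "fraction R S a s \<subseteq> fraction R S b t"
    if carr: "a \<in> carrier R" "b \<in> carrier R" "s \<in> S" "t \<in> S" "u \<in> S"
      and eq: "u \<otimes> (t \<otimes> a) = u \<otimes> (s \<otimes> b)" for a b s t u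
  proof clarify
    fix c w assume "(c, w) \<in> fraction R S a s"
    then obtain v where c: "c \<in> carrier R" "w \<in> S" "v \<in> S"
      and v: "v \<otimes> (w \<otimes> a) = v \<otimes> (s \<otimes> c)"
      by (auto simp: fraction_def)
    \<comment> \<open>The denominator \<open>s\<close> has to be absorbed into the witness, as it need not be cancellable.\<close>
    have "(u \<otimes> v \<otimes> s) \<otimes> (w \<otimes> b) = (v \<otimes> w) \<otimes> (u \<otimes> (s \<otimes> b))"
      using carr c by (simp add: m_ac)
    also have "\<dots> = (u \<otimes> t) \<otimes> (v \<otimes> (w \<otimes> a))"
      unfolding eq[symmetric] using carr c by (simp add: m_ac)
    also have "\<dots> = (u \<otimes> v \<otimes> s) \<otimes> (t \<otimes> c)"
      unfolding v using carr c by (simp add: m_ac)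
    finally show "(c, w) \<in> fraction R S b t"
      using carr c by (auto simp: fraction_def intro!: S_mult)
  qed
  from assms *[of a b s t u] *[of b a t s u] show ?thesis by auto
qed

lemma fraction_eqD:
  assumes "fraction R S a s = fraction R S b t"
    and "a \<in> carrier R" "b \<in> carrier R" "s \<in> S" "t \<in> S"
  obtains u where "u \<in> S" "u \<otimes> (t \<otimes> a) = u \<otimes> (s \<otimes> b)"
proof -
  have "(b, t) \<in> fraction R S b t"
    using assms S_one by (auto simp: fraction_def)
  with assms(1) have "(b, t) \<in> fraction R S a s" by simp
  then show ?thesis using that by (auto simp: fraction_def)
qed

text \<open>
  The ring operations of the localization are unions over all representatives; such a union
  collapses to the value at any one pair of representatives as soon as the value depends on the
  classes only.
\<close>

lemma union_over_class:
  assumes "a \<in> carrier R" "s \<in> S" "b \<in> carrier R" "t \<in> S"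
    and F: "\<And>a' s' b' t'. \<lbrakk>(a', s') \<in> fraction R S a s; (b', t') \<in> fraction R S b t\<rbrakk>
      \<Longrightarrow> F a' s' b' t' = F a s b t"
  shows "(\<Union>(a', s') \<in> fraction R S a s. \<Union>(b', t') \<in> fraction R S b t. F a' s' b' t') = F a s b t"
proof -
  have "(a, s) \<in> fraction R S a s" "(b, t) \<in> fraction R S b t"
    using assms S_one by (auto simp: fraction_def)
  with F show ?thesis by blast
qed

lemma localization_mult:
  assumes "a \<in> carrier R" "s \<in> S" "b \<in> carrier R" "t \<in> S"
  shows "fraction R S a s \<otimes>\<^bsub>localization R S\<^esub> fraction R S b t = fraction R S (a \<otimes> b) (s \<otimes> t)"
  unfolding localization_def monoid.simps
proof (rule union_over_class[OF assms])
  fix a' s' b' t' assume "(a', s') \<in> fraction R S a s" "(b', t') \<in> fraction R S b t"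
  then obtain u v where carr: "a' \<in> carrier R" "s' \<in> S" "b' \<in> carrier R" "t' \<in> S" "u \<in> S" "v \<in> S"
    and u: "u \<otimes> (s' \<otimes> a) = u \<otimes> (s \<otimes> a')" and v: "v \<otimes> (t' \<otimes> b) = v \<otimes> (t \<otimes> b')"
    by (auto simp: fraction_def)
  have "(u \<otimes> v) \<otimes> ((s' \<otimes> t') \<otimes> (a \<otimes> b)) = (u \<otimes> (s' \<otimes> a)) \<otimes> (v \<otimes> (t' \<otimes> b))"
    using carr assms by (simp add: m_ac)
  also have "\<dots> = (u \<otimes> v) \<otimes> ((s \<otimes> t) \<otimes> (a' \<otimes> b'))"
    unfolding u v using carr assms by (simp add: m_ac)
  finally show "fraction R S (a' \<otimes> b') (s' \<otimes> t') = fraction R S (a \<otimes> b) (s \<otimes> t)"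
    using carr assms by (intro fraction_eqI[of _ _ _ _ "u \<otimes> v"]) (auto intro: S_mult)
qed

lemma localization_add:
  assumes "a \<in> carrier R" "s \<in> S" "b \<in> carrier R" "t \<in> S"
  shows "fraction R S a s \<oplus>\<^bsub>localization R S\<^esub> fraction R S b t
    = fraction R S ((t \<otimes> a) \<oplus> (s \<otimes> b)) (s \<otimes> t)"
  unfolding localization_def ring_record_simps
proof (rule union_over_class[OF assms])
  fix a' s' b' t' assume "(a', s') \<in> fraction R S a s" "(b', t') \<in> fraction R S b t"
  then obtain u v where carr: "a' \<in> carrier R" "s' \<in> S" "b' \<in> carrier R" "t' \<in> S" "u \<in> S" "v \<in> S"
    and u: "u \<otimes> (s' \<otimes> a) = u \<otimes> (s \<otimes> a')" and v: "v \<otimes> (t' \<otimes> b) = v \<otimes> (t \<otimes> b')"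
    by (auto simp: fraction_def)
  have "(u \<otimes> v) \<otimes> ((s' \<otimes> t') \<otimes> ((t \<otimes> a) \<oplus> (s \<otimes> b)))
      = (v \<otimes> t \<otimes> t') \<otimes> (u \<otimes> (s' \<otimes> a)) \<oplus> (u \<otimes> s \<otimes> s') \<otimes> (v \<otimes> (t' \<otimes> b))"
    using carr assms by (simp add: m_ac r_distr)
  also have "\<dots> = (u \<otimes> v) \<otimes> ((s \<otimes> t) \<otimes> ((t' \<otimes> a') \<oplus> (s' \<otimes> b')))"
    unfolding u v using carr assms by (simp add: m_ac r_distr)
  finally show "fraction R S ((t' \<otimes> a') \<oplus> (s' \<otimes> b')) (s' \<otimes> t')
      = fraction R S ((t \<otimes> a) \<oplus> (s \<otimes> b)) (s \<otimes> t)"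
    using carr assms by (intro fraction_eqI[of _ _ _ _ "u \<otimes> v"]) (auto intro: S_mult)
qed

lemma localization_carrier:
  "carrier (localization R S) = {fraction R S a s | a s. a \<in> carrier R \<and> s \<in> S}"
  by (simp add: localization_def)

lemma localization_one: "\<one>\<^bsub>localization R S\<^esub> = fraction R S \<one> \<one>"
  by (simp add: localization_def)

lemma localization_zero: "\<zero>\<^bsub>localization R S\<^esub> = fraction R S \<zero> \<one>"
  by (simp add: localization_def)

lemma fraction_closed:
  "\<lbrakk>a \<in> carrier R; s \<in> S\<rbrakk> \<Longrightarrow> fraction R S a s \<in> carrier (localization R S)"
  by (auto simp: localization_carrier)

lemma fraction_cases:
  assumes "x \<in> carrier (localization R S)"
  obtains a s where "a \<in> carrier R" "s \<in> S" "x = fraction R S a s"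
  using assms by (auto simp: localization_carrier)

lemma fraction_zero:
  assumes "s \<in> S" shows "fraction R S \<zero> s = \<zero>\<^bsub>localization R S\<^esub>"
  unfolding localization_zero
  using assms S_one by (intro fraction_eqI[of _ _ _ _ \<one>]) auto

lemmas localization_simps =
  localization_mult localization_add localization_one localization_zero fraction_closed
  S_one S_mult

lemma localization_cring: "cring (localization R S)"
proof (intro cringI abelian_groupI comm_monoidI)
  fix x y z
  assume "x \<in> carrier (localization R S)" "y \<in> carrier (localization R S)"
    "z \<in> carrier (localization R S)"
  then obtain a s b t c w where xyz: "x = fraction R S a s" "y = fraction R S b t" "z = fraction R S c w"
    and carr: "a \<in> carrier R" "s \<in> S" "b \<in> carrier R" "t \<in> S" "c \<in> carrier R" "w \<in> S"
    by (metis fraction_cases)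
  show "(x \<oplus>\<^bsub>localization R S\<^esub> y) \<oplus>\<^bsub>localization R S\<^esub> z
      = x \<oplus>\<^bsub>localization R S\<^esub> (y \<oplus>\<^bsub>localization R S\<^esub> z)"
    unfolding xyz using carr by (simp add: localization_simps m_ac r_distr a_ac)
  show "(x \<otimes>\<^bsub>localization R S\<^esub> y) \<otimes>\<^bsub>localization R S\<^esub> z
      = x \<otimes>\<^bsub>localization R S\<^esub> (y \<otimes>\<^bsub>localization R S\<^esub> z)"
    unfolding xyz using carr by (simp add: localization_simps m_ac)
  show "(x \<oplus>\<^bsub>localization R S\<^esub> y) \<otimes>\<^bsub>localization R S\<^esub> z
      = x \<otimes>\<^bsub>localization R S\<^esub> z \<oplus>\<^bsub>localization R S\<^esub> y \<otimes>\<^bsub>localization R S\<^esub> z"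
    unfolding xyz using carr
    by (simp add: localization_simps, intro fraction_eqI[of _ _ _ _ \<one>])
      (auto simp: S_one S_mult m_ac r_distr l_distr)
next
  fix x y
  assume "x \<in> carrier (localization R S)" "y \<in> carrier (localization R S)"
  then obtain a s b t where xy: "x = fraction R S a s" "y = fraction R S b t"
    and carr: "a \<in> carrier R" "s \<in> S" "b \<in> carrier R" "t \<in> S"
    by (metis fraction_cases)
  show "x \<oplus>\<^bsub>localization R S\<^esub> y \<in> carrier (localization R S)"
    "x \<otimes>\<^bsub>localization R S\<^esub> y \<in> carrier (localization R S)"
    unfolding xy using carr by (simp_all add: localization_simps)
  show "x \<oplus>\<^bsub>localization R S\<^esub> y = y \<oplus>\<^bsub>localization R S\<^esub> x"
    unfolding xy using carr by (simp add: localization_simps m_ac a_ac)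
  show "x \<otimes>\<^bsub>localization R S\<^esub> y = y \<otimes>\<^bsub>localization R S\<^esub> x"
    unfolding xy using carr by (simp add: localization_simps m_ac)
next
  fix x assume "x \<in> carrier (localization R S)"
  then obtain a s where x: "x = fraction R S a s" and carr: "a \<in> carrier R" "s \<in> S"
    by (metis fraction_cases)
  show "\<zero>\<^bsub>localization R S\<^esub> \<oplus>\<^bsub>localization R S\<^esub> x = x"
    "\<one>\<^bsub>localization R S\<^esub> \<otimes>\<^bsub>localization R S\<^esub> x = x"
    unfolding x using carr by (simp_all add: localization_simps)
  have "fraction R S (\<ominus> a) s \<oplus>\<^bsub>localization R S\<^esub> x = \<zero>\<^bsub>localization R S\<^esub>"
    unfolding x using carr by (simp add: localization_add r_minus l_neg fraction_zero S_mult)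
  then show "\<exists>y\<in>carrier (localization R S). y \<oplus>\<^bsub>localization R S\<^esub> x = \<zero>\<^bsub>localization R S\<^esub>"
    using carr by (auto intro: fraction_closed)
qed (simp_all add: localization_simps)

text \<open>
  The fractions with numerator in \<open>J\<close> form an ideal, so they are the whole extension of \<open>J\<close>. If
  \<open>a / 1 = j / s\<close>, then \<open>u s a = u j \<in> J\<close> for some \<open>u \<in> S\<close>; conversely, \<open>a / 1\<close> is
  \<open>1 / s\<close> times \<open>s a / 1\<close>.
\<close>

lemma mem_extension_iff:
  assumes J: "ideal J R" and a: "a \<in> carrier R"
  shows "fraction R S a \<one> \<in> Idl\<^bsub>localization R S\<^esub> ((\<lambda>a. fraction R S a \<one>) ` J)
    \<longleftrightarrow> (\<exists>s\<in>S. s \<otimes> a \<in> J)"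
proof
  interpret J: ideal J R by fact
  interpret L: cring "localization R S" by (rule localization_cring)
  let ?L = "localization R S"
  define F where "F = {fraction R S j s | j s. j \<in> J \<and> s \<in> S}"
  have "ideal F ?L"
  proof (rule L.idealI_closed)
    show "F \<subseteq> carrier ?L"
      unfolding F_def by (auto intro!: fraction_closed J.Icarr)
    show "\<zero>\<^bsub>?L\<^esub> \<in> F"
      unfolding F_def localization_zero using J.zero_closed S_one by blast
  next
    fix x y assume "x \<in> F" "y \<in> F"
    then obtain i s j t where "x = fraction R S i s" "y = fraction R S j t"
      and ij: "i \<in> J" "s \<in> S" "j \<in> J" "t \<in> S" by (auto simp: F_def)
    then have "x \<oplus>\<^bsub>?L\<^esub> y = fraction R S ((t \<otimes> i) \<oplus> (s \<otimes> j)) (s \<otimes> t)"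
      by (simp add: localization_add J.Icarr)
    moreover have "(t \<otimes> i) \<oplus> (s \<otimes> j) \<in> J" using ij by (simp add: J.I_l_closed)
    ultimately show "x \<oplus>\<^bsub>?L\<^esub> y \<in> F" unfolding F_def using ij S_mult by blast
  next
    fix x y assume "x \<in> F" "y \<in> carrier ?L"
    then obtain i s j t where "x = fraction R S i s" "y = fraction R S j t"
      and ij: "i \<in> J" "s \<in> S" "j \<in> carrier R" "t \<in> S" by (auto simp: F_def localization_carrier)
    then have "y \<otimes>\<^bsub>?L\<^esub> x = fraction R S (j \<otimes> i) (t \<otimes> s)"
      by (simp add: localization_mult J.Icarr)
    moreover have "j \<otimes> i \<in> J" using ij by (simp add: J.I_l_closed)
    ultimately show "y \<otimes>\<^bsub>?L\<^esub> x \<in> F" unfolding F_def using ij S_mult by blast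
  qed
  moreover have "(\<lambda>a. fraction R S a \<one>) ` J \<subseteq> F" unfolding F_def using S_one by blast
  ultimately have sub: "Idl\<^bsub>?L\<^esub> ((\<lambda>a. fraction R S a \<one>) ` J) \<subseteq> F"
    by (rule L.genideal_minimal)
  assume "fraction R S a \<one> \<in> Idl\<^bsub>?L\<^esub> ((\<lambda>a. fraction R S a \<one>) ` J)"
  with sub obtain j s where js: "j \<in> J" "s \<in> S" "fraction R S a \<one> = fraction R S j s"
    by (auto simp: F_def)
  then obtain u where "u \<in> S" "u \<otimes> (s \<otimes> a) = u \<otimes> (\<one> \<otimes> j)"
    using a S_one J.Icarr by (metis fraction_eqD)
  then have "u \<otimes> s \<in> S" "(u \<otimes> s) \<otimes> a \<in> J"
    using js a J.I_l_closed[of j u] by (auto simp: m_assoc S_mult J.Icarr)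
  then show "\<exists>s\<in>S. s \<otimes> a \<in> J" by blast
next
  interpret J: ideal J R by fact
  interpret L: cring "localization R S" by (rule localization_cring)
  let ?L = "localization R S" and ?G = "(\<lambda>a. fraction R S a \<one>) ` J"
  have G: "?G \<subseteq> carrier ?L" using S_one by (auto intro!: fraction_closed J.Icarr)
  interpret G: ideal "Idl\<^bsub>?L\<^esub> ?G" ?L by (rule L.genideal_ideal[OF G])
  assume "\<exists>s\<in>S. s \<otimes> a \<in> J"
  then obtain s where s: "s \<in> S" "s \<otimes> a \<in> J" by blast
  then have "fraction R S (s \<otimes> a) \<one> \<in> Idl\<^bsub>?L\<^esub> ?G"
    using L.genideal_self[OF G] by blast
  then have "fraction R S \<one> s \<otimes>\<^bsub>?L\<^esub> fraction R S (s \<otimes> a) \<one> \<in> Idl\<^bsub>?L\<^esub> ?G"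
    using s by (intro G.I_l_closed) (auto intro: fraction_closed)
  also have "fraction R S \<one> s \<otimes>\<^bsub>?L\<^esub> fraction R S (s \<otimes> a) \<one> = fraction R S (s \<otimes> a) s"
    using s a S_one by (simp add: localization_mult)
  also have "\<dots> = fraction R S a \<one>"
    using s a S_one by (intro fraction_eqI[of _ _ _ _ \<one>]) auto
  finally show "fraction R S a \<one> \<in> Idl\<^bsub>?L\<^esub> ?G" .
qed

end

text \<open>
  For a prime \<open>P\<close> this is \<open>J R\<^sub>P \<inter> R\<close>, in terms of \<open>R\<close> alone.
\<close>

definition saturation :: "('a, 'b) ring_scheme \<Rightarrow> 'a set \<Rightarrow> 'a set \<Rightarrow> 'a set" where
  "saturation R P J = {a \<in> carrier R. \<exists>s \<in> carrier R - P. s \<otimes>\<^bsub>R\<^esub> a \<in> J}"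

lemma (in primeideal) complement_fractions: "fractions R (carrier R - I)"
proof unfold_locales
  show "\<one> \<in> carrier R - I" using I_notcarr one_imp_carrier by auto
qed (use I_prime in auto)

lemma (in primeideal) extend_contract_at_eq_saturation:
  assumes "ideal J R"
  shows "extend_contract_at R I J = saturation R I J"
proof -
  interpret fractions R "carrier R - I" by (rule complement_fractions)
  show ?thesis
    unfolding extend_contract_at_def extend_at_def to_localization_at_def saturation_def
    using mem_extension_iff[OF assms] by auto
qed

lemma (in primeideal) saturation_ideal:
  assumes "ideal J R"
  shows "ideal (saturation R I J) R"
proof -
  interpret J: ideal J R by fact
  interpret fractions R "carrier R - I" by (rule complement_fractions)
  show ?thesis
  proof (rule idealI_closed)
    show "saturation R I J \<subseteq> carrier R" by (auto simp: saturation_def)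
    show "\<zero> \<in> saturation R I J" using S_one by (auto simp: saturation_def intro!: bexI[of _ \<one>])
  next
    fix a b assume "a \<in> saturation R I J" "b \<in> saturation R I J"
    then obtain s t where ab: "a \<in> carrier R" "b \<in> carrier R" "s \<otimes> a \<in> J" "t \<otimes> b \<in> J"
      and st: "s \<in> carrier R - I" "t \<in> carrier R - I"
      by (auto simp: saturation_def)
    have "(s \<otimes> t) \<otimes> (a \<oplus> b) = t \<otimes> (s \<otimes> a) \<oplus> s \<otimes> (t \<otimes> b)"
      using ab st by (simp add: r_distr m_ac)
    also have "\<dots> \<in> J" using ab st by (simp add: J.I_l_closed)
    finally show "a \<oplus> b \<in> saturation R I J"
      using ab S_mult[OF st] unfolding saturation_def by blast
  next
    fix a x assume "a \<in> saturation R I J" and x: "x \<in> carrier R"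
    then obtain s where a: "a \<in> carrier R" "s \<otimes> a \<in> J" and s: "s \<in> carrier R - I"
      by (auto simp: saturation_def)
    have "s \<otimes> (x \<otimes> a) = x \<otimes> (s \<otimes> a)" using a s x by (simp add: m_ac)
    also have "\<dots> \<in> J" using a x by (simp add: J.I_l_closed)
    finally show "x \<otimes> a \<in> saturation R I J"
      using a x s unfolding saturation_def by blast
  qed
qed

lemma (in ring) ideal_prod_leI:
  assumes "ideal K R" and "\<And>a b. \<lbrakk>a \<in> I; b \<in> J\<rbrakk> \<Longrightarrow> a \<otimes> b \<in> K"
  shows "I \<cdot> J \<subseteq> K"
proof
  interpret K: ideal K R by fact
  fix x assume "x \<in> I \<cdot> J"
  then show "x \<in> K" by induction (auto intro: assms)
qed

lemma ideal_power_0: "ideal_power R I 0 = carrier R"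
  by (simp add: ideals_set_def nat_pow_def)

lemma ideal_power_Suc: "ideal_power R I (Suc k) = ideal_power R I k \<cdot>\<^bsub>R\<^esub> I"
  by (simp add: ideals_set_def nat_pow_def)

lemma (in ring) ideal_power_ideal: "ideal I R \<Longrightarrow> ideal (ideal_power R I k) R"
  by (induction k) (auto simp only: ideal_power_0 ideal_power_Suc oneideal ideal_prod_is_ideal)

lemma (in ring) ideal_power_mono:
  assumes "I \<subseteq> J" shows "ideal_power R I k \<subseteq> ideal_power R J k"
proof (induction k)
  case (Suc k)
  have "x \<in> ideal_power R J k \<cdot> J" if "x \<in> ideal_power R I k \<cdot> I" for x
    using that by induction (use Suc assms in \<open>auto intro: ideal_prod.intros\<close>)
  then show ?case by (auto simp only: ideal_power_Suc)
qed (simp add: ideal_power_0)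

text \<open>
  A product of \<open>a\<close> with \<open>s a \<in> J\<^sup>k\<close> and \<open>b\<close> with \<open>t b \<in> J\<close> has denominator \<open>s t\<close>,
  which is not in the prime ideal. A sum of such products stays in the saturation because the
  latter is an ideal.
\<close>

lemma (in primeideal) power_saturation_subset:
  assumes J: "ideal J R"
  shows "ideal_power R (saturation R I J) k \<subseteq> saturation R I (ideal_power R J k)"
proof (induction k)
  case 0
  have "\<one> \<in> carrier R - I" using I_notcarr one_imp_carrier by auto
  then show ?case unfolding ideal_power_0 saturation_def by fastforce
next
  case (Suc k)
  interpret fractions R "carrier R - I" by (rule complement_fractions)
  have "ideal_power R (saturation R I J) k \<cdot> saturation R I J
      \<subseteq> saturation R I (ideal_power R J k \<cdot> J)"
  proof (rule ideal_prod_leI)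
    show "ideal (saturation R I (ideal_power R J k \<cdot> J)) R"
      by (intro saturation_ideal ideal_prod_is_ideal ideal_power_ideal J)
    fix a b assume "a \<in> ideal_power R (saturation R I J) k" "b \<in> saturation R I J"
    with Suc have "a \<in> saturation R I (ideal_power R J k)" "b \<in> saturation R I J" by auto
    then obtain s t where ab: "a \<in> carrier R" "b \<in> carrier R" "s \<otimes> a \<in> ideal_power R J k" "t \<otimes> b \<in> J"
      and st: "s \<in> carrier R - I" "t \<in> carrier R - I"
      unfolding saturation_def by blast
    have "(s \<otimes> t) \<otimes> (a \<otimes> b) = (s \<otimes> a) \<otimes> (t \<otimes> b)"
      using ab st by (simp add: m_ac)
    also have "\<dots> \<in> ideal_power R J k \<cdot> J" using ab by (intro ideal_prod.prod)
    finally show "a \<otimes> b \<in> saturation R I (ideal_power R J k \<cdot> J)"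
      using ab S_mult[OF st] unfolding saturation_def by blast
  qed
  then show ?case by (simp only: ideal_power_Suc)
qed

section \<open>Primary components at the minimal primes\<close>

text \<open>
  This replaces the binomial theorem in the proof that a radical is closed under sums. The
  factor \<open>c\<close> makes the induction work: splitting one factor \<open>a \<oplus> b\<close> off the power moves
  \<open>a\<close> or \<open>b\<close> into \<open>c\<close> and lowers \<open>k\<close> or \<open>l\<close>.
\<close>

lemma (in ideal) add_pow_mem:
  assumes "cring R" "a \<in> carrier R" "b \<in> carrier R" "c \<in> carrier R"
    and "c \<otimes> a [^] (k::nat) \<in> I" "c \<otimes> b [^] (l::nat) \<in> I"
  shows "c \<otimes> (a \<oplus> b) [^] (k + l) \<in> I"
  using assms(4-)
proof (induction "k + l" arbitrary: k l c)
  case (Suc n)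
  interpret cring R by fact
  note ab [simp] = assms(2,3) and c [simp] = Suc.prems(1)
  show ?case
  proof (cases "k = 0 \<or> l = 0")
    case True
    then have "c \<in> I" using Suc.prems by auto
    then show ?thesis by (simp add: I_r_closed)
  next
    case False
    then obtain k' l' where kl: "k = Suc k'" "l = Suc l'" by (meson not0_implies_Suc)
    have shift: "(c \<otimes> x) \<otimes> y [^] j \<in> I"
      if "c \<otimes> y [^] j \<in> I" "x \<in> carrier R" "y \<in> carrier R" for x y and j :: nat
    proof -
      have "(c \<otimes> x) \<otimes> y [^] j = x \<otimes> (c \<otimes> y [^] j)" using that by (simp add: m_ac)
      then show ?thesis using I_l_closed[OF that(1,2)] by simp
    qed
    have absorb: "(c \<otimes> x) \<otimes> x [^] j = c \<otimes> x [^] Suc j" if "x \<in> carrier R" for x and j :: nat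
      using that by (simp add: m_ac)
    have "(c \<otimes> a) \<otimes> a [^] k' \<in> I" "(c \<otimes> b) \<otimes> b [^] l' \<in> I"
      using Suc.prems kl by (simp_all only: absorb ab)
    moreover have "(c \<otimes> a) \<otimes> b [^] l \<in> I" "(c \<otimes> b) \<otimes> a [^] k \<in> I"
      using Suc.prems by (simp_all only: shift ab)
    moreover have "n = k' + l" "n = k + l'" using Suc.hyps(2) kl by auto
    ultimately have "(c \<otimes> a) \<otimes> (a \<oplus> b) [^] (k' + l) \<in> I"
      "(c \<otimes> b) \<otimes> (a \<oplus> b) [^] (k + l') \<in> I"
      using Suc.hyps(1)[of k' l "c \<otimes> a"] Suc.hyps(1)[of k l' "c \<otimes> b"] by auto
    then have "(c \<otimes> a) \<otimes> (a \<oplus> b) [^] (k' + l) \<oplus> (c \<otimes> b) \<otimes> (a \<oplus> b) [^] (k + l') \<in> I"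
      by simp
    also have "(c \<otimes> a) \<otimes> (a \<oplus> b) [^] (k' + l) \<oplus> (c \<otimes> b) \<otimes> (a \<oplus> b) [^] (k + l')
        = c \<otimes> (a \<oplus> b) [^] (k + l)"
      by (simp add: kl m_ac l_distr r_distr)
    finally show ?thesis .
  qed
qed (simp add: assms)

lemma (in primaryideal) radical_primeideal: "primeideal (radical R I) R"
proof (rule primeidealI)
  show "ideal (radical R I) R"
  proof (rule idealI_closed)
    show "radical R I \<subseteq> carrier R" by (auto simp: radical_def)
    show "\<zero> \<in> radical R I" by (auto simp: radical_def intro!: exI[of _ 1])
  next
    fix a b assume "a \<in> radical R I" "b \<in> radical R I"
    then obtain k l :: nat where "a \<in> carrier R" "b \<in> carrier R" "a [^] k \<in> I" "b [^] l \<in> I"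
      by (auto simp: radical_def)
    with add_pow_mem[OF is_cring, of a b \<one> k l] show "a \<oplus> b \<in> radical R I"
      by (auto simp: radical_def)
  next
    fix a x assume "a \<in> radical R I" "x \<in> carrier R"
    then show "x \<otimes> a \<in> radical R I"
      by (auto simp: radical_def nat_pow_distrib intro: I_l_closed)
  qed
  show "cring R" by (rule is_cring)
  have "\<one> \<notin> radical R I"
    using I_notcarr one_imp_carrier by (auto simp: radical_def)
  then show "carrier R \<noteq> radical R I" by auto
  fix a b assume ab: "a \<in> carrier R" "b \<in> carrier R" "a \<otimes> b \<in> radical R I"
  then obtain k :: nat where "a [^] k \<otimes> b [^] k \<in> I"
    by (auto simp: radical_def nat_pow_distrib)
  with ab I_primary[of "a [^] k" "b [^] k"] show "a \<in> radical R I \<or> b \<in> radical R I"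
    by (auto simp: radical_def nat_pow_pow)
qed

lemma (in primaryideal) subset_radical: "I \<subseteq> radical R I"
proof
  fix a assume "a \<in> I"
  then show "a \<in> radical R I" by (auto simp: radical_def intro!: exI[of _ 1])
qed

lemma (in primeideal) pow_mem_imp_mem:
  assumes "a \<in> carrier R" "a [^] (k::nat) \<in> I"
  shows "a \<in> I"
  using assms(2)
proof (induction k)
  case 0 then show ?case using I_notcarr one_imp_carrier by auto
next
  case (Suc k) then show ?case using I_prime[of "a [^] k" a] assms(1) by auto
qed

lemma (in primeideal) radical_subset: "J \<subseteq> I \<Longrightarrow> radical R J \<subseteq> I"
  unfolding radical_def by (blast intro: pow_mem_imp_mem)

text \<open>
  The element is the product of one element of each \<open>Q i\<close> outside the prime.
\<close>

lemma (in primeideal) prime_avoids_INT: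
  assumes "finite A" and "\<And>i. i \<in> A \<Longrightarrow> ideal (Q i) R" and "\<And>i. i \<in> A \<Longrightarrow> \<not> Q i \<subseteq> I"
  obtains s where "s \<in> ideal_INT R A Q" "s \<notin> I"
proof -
  have "\<exists>s. s \<in> ideal_INT R A Q \<and> s \<notin> I"
    using assms
  proof (induction A)
    case empty
    have "\<one> \<notin> I" using I_notcarr one_imp_carrier by auto
    then show ?case by (auto simp: ideal_INT_def intro!: exI[of _ \<one>])
  next
    case (insert i A)
    then obtain s where s: "s \<in> ideal_INT R A Q" "s \<notin> I" by auto
    from insert.prems obtain t where t: "t \<in> Q i" "t \<notin> I" by blast
    have carr: "s \<in> carrier R" "t \<in> carrier R"
      using s t insert.prems(1)[of i] by (auto simp: ideal_INT_def ideal.Icarr)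
    have "s \<otimes> t \<notin> I" using I_prime carr s t by blast
    moreover have "s \<otimes> t \<in> ideal_INT R (insert i A) Q"
      using s t carr insert.prems(1)
      by (auto simp: ideal_INT_def intro: ideal.I_l_closed ideal.I_r_closed)
    ultimately show ?case by blast
  qed
  then show ?thesis using that by blast
qed

lemma minimal_primes_unique:
  assumes "P \<in> minimal_primes R I" "primeideal P' R" "I \<subseteq> P'" "P' \<subseteq> P"
  shows "P' = P"
  using assms unfolding minimal_primes_def by blast

locale minimal_primary_decomp = cring +
  fixes I :: "'a set" and Q :: "nat \<Rightarrow> 'a set" and m :: nat
  assumes decomp: "minimal_primary_decomposition R I Q m"
begin

lemma component_primary: "i \<in> {1..m} \<Longrightarrow> primaryideal (Q i) R"
  and decomp_eq: "I = ideal_INT R {1..m} Q"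
  and radical_inj: "inj_on (\<lambda>i. radical R (Q i)) {1..m}"
  using decomp unfolding minimal_primary_decomposition_def by blast+

lemma component_ideal: "i \<in> {1..m} \<Longrightarrow> ideal (Q i) R"
  using component_primary primaryideal.axioms(1) by blast

lemma subset_radical_component: "i \<in> {1..m} \<Longrightarrow> I \<subseteq> radical R (Q i)"
  using primaryideal.subset_radical[OF component_primary] unfolding decomp_eq ideal_INT_def by blast

text \<open>
  The prime contains the intersection of the components, hence one of them, hence the radical of
  that one; the latter is prime and contains \<open>I\<close>, so minimality gives equality.
\<close>

lemma minimal_prime_is_radical:
  assumes "P \<in> minimal_primes R I"
  obtains i where "i \<in> {1..m}" "P = radical R (Q i)"
proof -
  interpret P: primeideal P R using assms by (simp add: minimal_primes_def)
  have "\<exists>i\<in>{1..m}. Q i \<subseteq> P"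
  proof (rule ccontr)
    assume "\<not> (\<exists>i\<in>{1..m}. Q i \<subseteq> P)"
    then have "\<not> Q i \<subseteq> P" if "i \<in> {1..m}" for i using that by blast
    with component_ideal obtain s where "s \<in> ideal_INT R {1..m} Q" "s \<notin> P"
      by (rule P.prime_avoids_INT[OF finite_atLeastAtMost])
    moreover have "I \<subseteq> P" using assms by (simp add: minimal_primes_def)
    ultimately show False using decomp_eq by blast
  qed
  then obtain i where i: "i \<in> {1..m}" "Q i \<subseteq> P" by blast
  have "radical R (Q i) \<subseteq> P" by (rule P.radical_subset[OF i(2)])
  then have "radical R (Q i) = P"
    by (rule minimal_primes_unique[OF assms
          primaryideal.radical_primeideal[OF component_primary[OF i(1)]]
          subset_radical_component[OF i(1)]])
  with i(1) that show ?thesis by blast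
qed

text \<open>
  The uniqueness of isolated components. If \<open>s a \<in> I \<subseteq> Q i\<close> with \<open>s\<close> outside the
  radical of \<open>Q i\<close>, then \<open>a \<in> Q i\<close> as \<open>Q i\<close> is primary. Conversely, no other component lies
  inside the minimal prime, since its radical would then equal that prime and the radicals are
  distinct; so some \<open>s\<close> outside the prime lies in all other components, and it multiplies \<open>Q i\<close>
  into \<open>I\<close>.
\<close>

lemma saturation_at_minimal_prime:
  assumes i: "i \<in> {1..m}" and minimal: "radical R (Q i) \<in> minimal_primes R I"
  shows "saturation R (radical R (Q i)) I = Q i"
proof
  interpret Q: primaryideal "Q i" R using component_primary[OF i] .
  let ?P = "radical R (Q i)"
  interpret P: primeideal ?P R by (rule Q.radical_primeideal)
  show "saturation R ?P I \<subseteq> Q i"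
  proof
    fix a assume "a \<in> saturation R ?P I"
    then obtain s where as: "a \<in> carrier R" "s \<in> carrier R" "s \<notin> ?P" "s \<otimes> a \<in> I"
      unfolding saturation_def by blast
    then have "s \<otimes> a \<in> Q i" using i unfolding decomp_eq ideal_INT_def by blast
    then have "a \<otimes> s \<in> Q i" using as by (simp add: m_comm)
    then have "a \<in> Q i \<or> s \<in> ?P"
      using Q.I_primary[of a s] as(1,2) unfolding radical_def by blast
    with as(3) show "a \<in> Q i" by blast
  qed
  have avoid: "\<not> Q j \<subseteq> ?P" if j: "j \<in> {1..m} - {i}" for j
  proof
    assume "Q j \<subseteq> ?P"
    then have "radical R (Q j) \<subseteq> ?P" by (rule P.radical_subset)
    moreover have j': "j \<in> {1..m}" using j by blast
    ultimately have "radical R (Q j) = ?P"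
      using minimal_primes_unique[OF minimal
          primaryideal.radical_primeideal[OF component_primary[OF j']]
          subset_radical_component[OF j']] by blast
    then have "j = i" using inj_onD[OF radical_inj _ j' i] by simp
    with j show False by simp
  qed
  have "ideal (Q j) R" if "j \<in> {1..m} - {i}" for j
    using that component_ideal by blast
  then obtain s where s: "s \<in> ideal_INT R ({1..m} - {i}) Q" "s \<notin> ?P"
    using avoid by (rule P.prime_avoids_INT[OF finite_Diff[OF finite_atLeastAtMost]])
  have sc: "s \<in> carrier R" using s(1) unfolding ideal_INT_def by blast
  show "Q i \<subseteq> saturation R ?P I"
  proof
    fix a assume a: "a \<in> Q i"
    have "s \<otimes> a \<in> Q j" if "j \<in> {1..m}" for j
    proof (cases "j = i")
      case False
      with that s(1) have "s \<in> Q j" unfolding ideal_INT_def by blast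
      then show ?thesis
        by (rule ideal.I_r_closed[OF component_ideal[OF that] _ Q.Icarr[OF a]])
    qed (use Q.I_l_closed[OF a sc] in simp)
    then have "s \<otimes> a \<in> I"
      using sc Q.Icarr[OF a] unfolding decomp_eq ideal_INT_def by blast
    then show "a \<in> saturation R ?P I"
      using s(2) sc Q.Icarr[OF a] unfolding saturation_def by blast
  qed
qed

end

section \<open>Spans of monomials\<close>

lemma mpoly_ring_simps [simp]:
  "p \<otimes>\<^bsub>mpoly_ring n\<^esub> q = p * q" "p \<oplus>\<^bsub>mpoly_ring n\<^esub> q = p + q"
  "\<one>\<^bsub>mpoly_ring n\<^esub> = 1" "\<zero>\<^bsub>mpoly_ring n\<^esub> = 0"
  by (simp_all add: mpoly_ring_def)

definition monomial_span :: "(nat \<Rightarrow>\<^sub>0 nat) set \<Rightarrow> ((nat \<Rightarrow>\<^sub>0 nat) \<Rightarrow>\<^sub>0 'k::field) set" where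
  "monomial_span T = {f. Poly_Mapping.keys f \<subseteq> T}"

lemma mpoly_ring_carrier: "carrier (mpoly_ring n) = monomial_span (exponents n)"
  by (simp add: mpoly_ring_def monomial_span_def)

lemma single_mem_monomial_span: "t \<in> T \<Longrightarrow> Poly_Mapping.single t c \<in> monomial_span T"
  by (simp add: monomial_span_def)

lemma exponents_add: "s \<in> exponents n \<Longrightarrow> t \<in> exponents n \<Longrightarrow> s + t \<in> exponents n"
  using Poly_Mapping.keys_add[of s t] by (auto simp: exponents_def)

lemma zero_mem_exponents: "0 \<in> exponents n"
  by (simp add: exponents_def)

lemma monomial_span_add: "f \<in> monomial_span T \<Longrightarrow> g \<in> monomial_span T \<Longrightarrow> f + g \<in> monomial_span T"
  using Poly_Mapping.keys_add[of f g] by (auto simp: monomial_span_def)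

lemma monomial_span_mult:
  assumes "f \<in> monomial_span S" "g \<in> monomial_span T"
    and "\<And>s t. \<lbrakk>s \<in> S; t \<in> T\<rbrakk> \<Longrightarrow> s + t \<in> U"
  shows "f * g \<in> monomial_span U"
  using Poly_Mapping.keys_mult[of f g] assms unfolding monomial_span_def by blast

lemma mpoly_ring_cring: "cring (mpoly_ring n)"
proof (intro cringI abelian_groupI comm_monoidI)
  fix x :: "(nat \<Rightarrow>\<^sub>0 nat) \<Rightarrow>\<^sub>0 'k::field"
  assume "x \<in> carrier (mpoly_ring n)"
  then have "- x \<in> carrier (mpoly_ring n)" by (simp add: mpoly_ring_carrier monomial_span_def)
  then show "\<exists>y\<in>carrier (mpoly_ring n). y \<oplus>\<^bsub>mpoly_ring n\<^esub> x = \<zero>\<^bsub>mpoly_ring n\<^esub>"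
    by (intro bexI[of _ "- x"]) auto
qed (auto simp: mpoly_ring_carrier algebra_simps single_mem_monomial_span zero_mem_exponents
    simp flip: single_one intro: monomial_span_add monomial_span_mult exponents_add,
    auto simp: monomial_span_def)

text \<open>
  Membership is monotone in the coordinates in \<open>A\<close> and independent of the others, i.e. \<open>T\<close> is
  the preimage of an up-closed set under the projection to these coordinates. The span of such a
  set is an ideal generated by monomials in the variables from \<open>A\<close>.
\<close>

definition cylinder_upset :: "nat \<Rightarrow> nat set \<Rightarrow> (nat \<Rightarrow>\<^sub>0 nat) set \<Rightarrow> bool" where
  "cylinder_upset n A T \<longleftrightarrow> T \<subseteq> exponents n \<and> (\<forall>t\<in>T. \<forall>u\<in>exponents n.
     (\<forall>a\<in>A. Poly_Mapping.lookup t a \<le> Poly_Mapping.lookup u a) \<longrightarrow> u \<in> T)"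

lemma cylinder_upsetD:
  assumes "cylinder_upset n A T" "t \<in> T" "u \<in> exponents n"
    and "\<And>a. a \<in> A \<Longrightarrow> Poly_Mapping.lookup t a \<le> Poly_Mapping.lookup u a"
  shows "u \<in> T"
  using assms unfolding cylinder_upset_def by blast

lemma cylinder_upset_exponents: "cylinder_upset n A T \<Longrightarrow> t \<in> T \<Longrightarrow> t \<in> exponents n"
  unfolding cylinder_upset_def by blast

lemma monomial_span_ideal:
  assumes T: "cylinder_upset n A T"
  shows "ideal (monomial_span T) (mpoly_ring n)"
proof (rule cring.idealI_closed[OF mpoly_ring_cring])
  show "monomial_span T \<subseteq> carrier (mpoly_ring n)"
    using cylinder_upset_exponents[OF T] unfolding mpoly_ring_carrier monomial_span_def by blast
  show "\<zero>\<^bsub>mpoly_ring n\<^esub> \<in> monomial_span T" by (simp add: monomial_span_def)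
  fix f g :: "(nat \<Rightarrow>\<^sub>0 nat) \<Rightarrow>\<^sub>0 'k::field"
  assume f: "f \<in> monomial_span T"
  show "f \<oplus>\<^bsub>mpoly_ring n\<^esub> g \<in> monomial_span T" if "g \<in> monomial_span T"
    using f that by (simp add: monomial_span_add)
  assume "g \<in> carrier (mpoly_ring n)"
  then have "g * f \<in> monomial_span T"
    unfolding mpoly_ring_carrier
  proof (rule monomial_span_mult[OF _ f])
    fix s t assume "s \<in> exponents n" "t \<in> T"
    then show "s + t \<in> T"
      using cylinder_upset_exponents[OF T]
      by - (rule cylinder_upsetD[OF T, of t], auto simp: lookup_add intro: exponents_add)
  qed
  then show "g \<otimes>\<^bsub>mpoly_ring n\<^esub> f \<in> monomial_span T" by simp
qed

lemma monomial_span_subset_ideal: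
  fixes J :: "((nat \<Rightarrow>\<^sub>0 nat) \<Rightarrow>\<^sub>0 'k::field) set"
  assumes J: "ideal J (mpoly_ring n)"
    and monomials: "\<And>t. t \<in> T \<Longrightarrow> Poly_Mapping.single t 1 \<in> J"
  shows "monomial_span T \<subseteq> J"
proof
  interpret ideal J "mpoly_ring n" by fact
  fix f :: "(nat \<Rightarrow>\<^sub>0 nat) \<Rightarrow>\<^sub>0 'k" assume "f \<in> monomial_span T"
  then have T: "Poly_Mapping.keys f \<subseteq> T" by (simp add: monomial_span_def)
  have "g \<in> J" if "Poly_Mapping.keys g \<subseteq> F" "finite F" "F \<subseteq> T"
    for F and g :: "(nat \<Rightarrow>\<^sub>0 nat) \<Rightarrow>\<^sub>0 'k"
    using that(2,1,3)
  proof (induction F arbitrary: g)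
    case empty
    then have "g = 0" by simp
    then show ?case using additive_subgroup.zero_closed[OF ideal.axioms(1)[OF J]] by simp
  next
    case (insert t F)
    define c where "c = Poly_Mapping.lookup g t"
    have "Poly_Mapping.keys (g - Poly_Mapping.single t c) \<subseteq> F"
    proof
      fix u assume u: "u \<in> Poly_Mapping.keys (g - Poly_Mapping.single t c)"
      then have "u \<noteq> t" by (auto simp: in_keys_iff lookup_minus c_def)
      with u have "u \<in> Poly_Mapping.keys g"
        by (auto simp: in_keys_iff lookup_minus lookup_single_not_eq)
      with \<open>u \<noteq> t\<close> insert.prems show "u \<in> F" by auto
    qed
    then have "g - Poly_Mapping.single t c \<in> J"
      using insert.IH insert.prems(2) by blast
    moreover have "Poly_Mapping.single 0 c * Poly_Mapping.single t 1 \<in> J"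
      using I_l_closed[OF monomials, of t "Poly_Mapping.single 0 c"] insert.prems
      by (simp add: mpoly_ring_carrier single_mem_monomial_span zero_mem_exponents)
    then have "Poly_Mapping.single t c \<in> J" by (simp add: mult_single)
    ultimately show ?case
      using additive_subgroup.a_closed[OF ideal.axioms(1)[OF J],
          of "g - Poly_Mapping.single t c" "Poly_Mapping.single t c"] by simp
  qed
  from this[OF order_refl finite_keys T] show "f \<in> J" .
qed

lemma lookup_mult_unique:
  fixes f g :: "(nat \<Rightarrow>\<^sub>0 nat) \<Rightarrow>\<^sub>0 'k::field"
  assumes s: "s \<in> Poly_Mapping.keys f" and t: "t \<in> Poly_Mapping.keys g"
    and unique: "\<And>s' t'. \<lbrakk>s' \<in> Poly_Mapping.keys f; t' \<in> Poly_Mapping.keys g; s' + t' = s + t\<rbrakk>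
      \<Longrightarrow> s' = s"
  shows "s + t \<in> Poly_Mapping.keys (f * g)"
proof -
  have *: "(\<Sum>q. Poly_Mapping.lookup g q when s + t = l + q) = (Poly_Mapping.lookup g t when l = s)"
    if l: "l \<in> Poly_Mapping.keys f" for l
  proof (cases "l = s")
    case True
    then have "(\<lambda>q. Poly_Mapping.lookup g q when s + t = l + q)
        = (\<lambda>q. Poly_Mapping.lookup g q when q = t)"
      by (auto simp: when_def fun_eq_iff)
    then show ?thesis using True by simp
  next
    case False
    then have "s + t \<noteq> l + q" if "q \<in> Poly_Mapping.keys g" for q
      using unique[OF l that] by auto
    then have "(\<lambda>q. Poly_Mapping.lookup g q when s + t = l + q) = (\<lambda>q. 0)"
      by (auto simp: when_def fun_eq_iff in_keys_iff)
    then have "(\<Sum>q. Poly_Mapping.lookup g q when s + t = l + q) = 0"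
      by (simp only: Sum_any.neutral)
    then show ?thesis using False by simp
  qed
  have eq: "(\<lambda>l. Poly_Mapping.lookup f l * (\<Sum>q. Poly_Mapping.lookup g q when s + t = l + q))
      = (\<lambda>l. Poly_Mapping.lookup f l * Poly_Mapping.lookup g t when l = s)"
  proof
    fix l
    show "Poly_Mapping.lookup f l * (\<Sum>q. Poly_Mapping.lookup g q when s + t = l + q)
      = (Poly_Mapping.lookup f l * Poly_Mapping.lookup g t when l = s)"
    proof (cases "l \<in> Poly_Mapping.keys f")
      case True then show ?thesis unfolding *[OF True] by (simp add: when_def)
    qed (simp add: in_keys_iff when_def)
  qed
  have "Poly_Mapping.lookup (f * g) (s + t) = Poly_Mapping.lookup f s * Poly_Mapping.lookup g t"
    unfolding lookup_mult eq by simp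
  then show ?thesis using s t by (simp add: in_keys_iff)
qed

text \<open>
  The ideals in question are saturated at the prime generated by the variables from \<open>A\<close>: a
  polynomial \<open>g\<close> is outside that prime exactly if it has a term \<open>v\<close> free of these variables.
  Compare exponents first by their total degree in the variables from \<open>A\<close>, then by the
  lexicographic order. The lowest term \<open>p\<close> of \<open>g\<close> has degree zero, so adding it does not affect
  membership in \<open>T\<close>. If \<open>q\<close> is the lowest term of \<open>f\<close> outside \<open>T\<close>, then \<open>p + q\<close> is outside \<open>T\<close>,
  and it arises in only one way: terms of \<open>f\<close> inside \<open>T\<close> contribute exponents in \<open>T\<close> only, and
  any other pair of terms has a larger sum. So \<open>p + q\<close> survives in the product.
\<close>

lemma monomial_span_cancel:
  fixes f g :: "(nat \<Rightarrow>\<^sub>0 nat) \<Rightarrow>\<^sub>0 'k::field"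
  assumes A: "finite A" and T: "cylinder_upset n A T"
    and g: "g \<in> monomial_span (exponents n)" and f: "f \<in> monomial_span (exponents n)"
    and v: "v \<in> Poly_Mapping.keys g" "\<forall>a\<in>A. Poly_Mapping.lookup v a = 0"
    and gf: "g * f \<in> monomial_span T"
  shows "f \<in> monomial_span T"
proof (rule ccontr)
  define deg where "deg u = (\<Sum>a\<in>A. Poly_Mapping.lookup u a)" for u :: "nat \<Rightarrow>\<^sub>0 nat"
  have deg_add: "deg (u + w) = deg u + deg w" for u w
    by (simp add: deg_def lookup_add sum.distrib)
  have deg_0: "deg u = 0 \<longleftrightarrow> (\<forall>a\<in>A. Poly_Mapping.lookup u a = 0)" for u
    using A by (simp add: deg_def)
  define V where "V = {u \<in> Poly_Mapping.keys g. deg u = 0}"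
  define W where "W = Poly_Mapping.keys f - T"
  assume "f \<notin> monomial_span T"
  then have W: "finite W" "W \<noteq> {}" by (auto simp: W_def monomial_span_def)
  define d where "d = Min (deg ` W)"
  have d: "d \<le> deg u" if "u \<in> W" for u using W that by (simp add: d_def)
  have "d \<in> deg ` W" using W by (simp add: d_def)
  define W' where "W' = {u \<in> W. deg u = d}"
  define p where "p = Min V"
  define q where "q = Min W'"
  have V: "finite V" "V \<noteq> {}" using v by (auto simp: V_def deg_0)
  have W': "finite W'" "W' \<noteq> {}" using W(1) \<open>d \<in> deg ` W\<close> by (auto simp: W'_def)
  have p: "p \<in> V" "\<And>u. u \<in> V \<Longrightarrow> p \<le> u" using V by (simp_all add: p_def)
  have q: "q \<in> W'" "\<And>u. u \<in> W' \<Longrightarrow> q \<le> u" using W' by (simp_all add: q_def)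
  have expo: "u \<in> exponents n" if "u \<in> Poly_Mapping.keys f \<or> u \<in> Poly_Mapping.keys g" for u
    using f g that by (auto simp: monomial_span_def)
  have pk: "p \<in> Poly_Mapping.keys g" "deg p = 0" using p(1) by (auto simp: V_def)
  have qk: "q \<in> Poly_Mapping.keys f" "q \<notin> T" "deg q = d" using q(1) by (auto simp: W'_def W_def)
  have pq: "p + q \<notin> T"
  proof
    assume "p + q \<in> T"
    then have "q \<in> T"
      by (rule cylinder_upsetD[OF T]) (use pk(2) expo qk(1) in \<open>auto simp: lookup_add deg_0\<close>)
    with qk show False by simp
  qed
  have "p + q \<in> Poly_Mapping.keys (g * f)"
  proof (rule lookup_mult_unique[OF pk(1) qk(1)])
    fix s t assume st: "s \<in> Poly_Mapping.keys g" "t \<in> Poly_Mapping.keys f" "s + t = p + q"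
    have "t \<notin> T"
    proof
      assume "t \<in> T"
      then have "s + t \<in> T"
        by (rule cylinder_upsetD[OF T])
          (use expo st(1,2) in \<open>auto simp: lookup_add intro: exponents_add\<close>)
      with pq st(3) show False by simp
    qed
    then have "t \<in> W" using st by (simp add: W_def)
    then have "d \<le> deg t" by (rule d)
    moreover have "deg s + deg t = d"
      using arg_cong[OF st(3), of deg] pk qk by (simp add: deg_add)
    ultimately have "s \<in> V" "t \<in> W'" using st \<open>t \<in> W\<close> by (auto simp: V_def W'_def)
    then have "p \<le> s" "q \<le> t" using p q by auto
    then show "s = p"
      using st(3) add_less_le_mono[of p s q t] by (auto simp: less_le)
  qed
  with gf pq show False by (auto simp: monomial_span_def)
qed

text \<open>
  An exponent \<open>w\<close> above \<open>t + u\<close> on \<open>A\<close> splits as the meet of \<open>w\<close> and \<open>t\<close> plus the rest: on \<open>A\<close>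
  the former equals \<open>t\<close>, so the latter is above \<open>u\<close> there.
\<close>

lemma cylinder_upset_sum:
  assumes T: "cylinder_upset n A T" and U: "cylinder_upset n A U"
  shows "cylinder_upset n A {t + u | t u. t \<in> T \<and> u \<in> U}"
  unfolding cylinder_upset_def
proof (intro conjI ballI impI)
  show "{t + u | t u. t \<in> T \<and> u \<in> U} \<subseteq> exponents n"
    using T U by (auto simp: cylinder_upset_def intro!: exponents_add)
next
  fix v w assume "v \<in> {t + u | t u. t \<in> T \<and> u \<in> U}" and w: "w \<in> exponents n"
    and le: "\<forall>a\<in>A. Poly_Mapping.lookup v a \<le> Poly_Mapping.lookup w a"
  then obtain t u where tu: "t \<in> T" "u \<in> U" "v = t + u" by auto
  \<comment> \<open>\<open>t'\<close> is the pointwise minimum of \<open>w\<close> and \<open>t\<close>.\<close>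
  define t' where "t' = Poly_Mapping.mapp (\<lambda>a k. min k (Poly_Mapping.lookup t a)) w"
  have t': "Poly_Mapping.lookup t' a = min (Poly_Mapping.lookup w a) (Poly_Mapping.lookup t a)" for a
    by (auto simp: t'_def lookup_mapp when_def in_keys_iff)
  define u' where "u' = w - t'"
  have u': "Poly_Mapping.lookup u' a = Poly_Mapping.lookup w a - Poly_Mapping.lookup t' a" for a
    by (simp add: u'_def lookup_minus)
  have "t' \<in> exponents n" "u' \<in> exponents n"
    using w by (auto simp: exponents_def in_keys_iff t' u' subset_iff)
  moreover have "Poly_Mapping.lookup t a \<le> Poly_Mapping.lookup t' a"
    "Poly_Mapping.lookup u a \<le> Poly_Mapping.lookup u' a" if "a \<in> A" for a
    using le that tu(3) by (force simp: t' u' lookup_add)+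
  ultimately have "t' \<in> T" "u' \<in> U"
    using cylinder_upsetD[OF T tu(1)] cylinder_upsetD[OF U tu(2)] by blast+
  moreover have "w = t' + u'"
    by (rule poly_mapping_eqI) (simp add: lookup_add t' u')
  ultimately show "w \<in> {t + u | t u. t \<in> T \<and> u \<in> U}" by blast
qed

lemma ideal_prod_monomial_span:
  assumes T: "cylinder_upset n A T" and U: "cylinder_upset n A U"
  shows "monomial_span T \<cdot>\<^bsub>mpoly_ring n\<^esub> monomial_span U
    = (monomial_span {t + u | t u. t \<in> T \<and> u \<in> U} :: (_ \<Rightarrow>\<^sub>0 'k::field) set)"
    (is "_ = ?S")
proof
  interpret cring "mpoly_ring n" by (rule mpoly_ring_cring)
  show "monomial_span T \<cdot>\<^bsub>mpoly_ring n\<^esub> monomial_span U \<subseteq> ?S"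
  proof (rule ideal_prod_leI[OF monomial_span_ideal[OF cylinder_upset_sum[OF T U]]])
    fix f g :: "_ \<Rightarrow>\<^sub>0 'k" assume "f \<in> monomial_span T" "g \<in> monomial_span U"
    then have "f * g \<in> ?S" by (rule monomial_span_mult) blast
    then show "f \<otimes>\<^bsub>mpoly_ring n\<^esub> g \<in> ?S" by simp
  qed
  show "?S \<subseteq> monomial_span T \<cdot>\<^bsub>mpoly_ring n\<^esub> monomial_span U"
  proof (rule monomial_span_subset_ideal)
    show "ideal (monomial_span T \<cdot>\<^bsub>mpoly_ring n\<^esub> monomial_span U) (mpoly_ring n)"
      by (intro ideal_prod_is_ideal monomial_span_ideal[OF T] monomial_span_ideal[OF U])
    fix v assume "v \<in> {t + u | t u. t \<in> T \<and> u \<in> U}"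
    then obtain t u where tu: "t \<in> T" "u \<in> U" "v = t + u" by auto
    have "Poly_Mapping.single t 1 \<otimes>\<^bsub>mpoly_ring n\<^esub> Poly_Mapping.single u 1
        \<in> monomial_span T \<cdot>\<^bsub>mpoly_ring n\<^esub> monomial_span U"
      using tu by (intro ideal_prod.prod single_mem_monomial_span)
    then show "Poly_Mapping.single v 1 \<in> monomial_span T \<cdot>\<^bsub>mpoly_ring n\<^esub> monomial_span U"
      using tu by (simp add: mult_single)
  qed
qed

lemma ideal_power_monomial_span:
  assumes T: "cylinder_upset n A T"
  obtains U where "cylinder_upset n A U"
    "ideal_power (mpoly_ring n) (monomial_span T :: (_ \<Rightarrow>\<^sub>0 'k::field) set) k = monomial_span U"
proof -
  have "\<exists>U. cylinder_upset n A U
    \<and> ideal_power (mpoly_ring n) (monomial_span T :: (_ \<Rightarrow>\<^sub>0 'k) set) k = monomial_span U"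
  proof (induction k)
    case 0
    have "cylinder_upset n A (exponents n)" by (simp add: cylinder_upset_def)
    then show ?case by (auto simp only: ideal_power_0 mpoly_ring_carrier)
  next
    case (Suc k)
    then obtain U where "cylinder_upset n A U"
      "ideal_power (mpoly_ring n) (monomial_span T :: (_ \<Rightarrow>\<^sub>0 'k) set) k = monomial_span U"
      by blast
    with ideal_prod_monomial_span[OF this(1) T] cylinder_upset_sum[OF this(1) T] show ?case
      by (auto simp only: ideal_power_Suc)
  qed
  with that show ?thesis by blast
qed

section \<open>Saturations of monomial ideals\<close>

abbreviation monom :: "(nat \<Rightarrow>\<^sub>0 nat) \<Rightarrow> (nat \<Rightarrow>\<^sub>0 nat) \<Rightarrow>\<^sub>0 'k::field" where
  "monom t \<equiv> Poly_Mapping.single t 1"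

text \<open>
  The exponents of the monomials in the prime ideal generated by the variables from \<open>A\<close>.
\<close>

definition meets :: "nat \<Rightarrow> nat set \<Rightarrow> (nat \<Rightarrow>\<^sub>0 nat) set" where
  "meets n A = {t \<in> exponents n. \<exists>a\<in>A. 0 < Poly_Mapping.lookup t a}"

lemma cylinder_upset_meets: "cylinder_upset n A (meets n A)"
  unfolding cylinder_upset_def meets_def by (fastforce intro: less_le_trans)

lemma not_mem_span_meetsE:
  assumes "f \<in> carrier (mpoly_ring n)" "f \<notin> monomial_span (meets n A)"
  obtains v where "v \<in> Poly_Mapping.keys f" "\<forall>a\<in>A. Poly_Mapping.lookup v a = 0"
  using assms unfolding mpoly_ring_carrier monomial_span_def meets_def by fastforce

text \<open>
  Primality is the cancellation property: a factor outside the span has a term without variables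
  from \<open>A\<close>, so the other factor lies in the span.
\<close>

lemma span_meets_prime:
  assumes A: "finite A"
  shows "primeideal (monomial_span (meets n A) :: (_ \<Rightarrow>\<^sub>0 'k::field) set) (mpoly_ring n)"
proof (rule primeidealI)
  show "ideal (monomial_span (meets n A) :: (_ \<Rightarrow>\<^sub>0 'k) set) (mpoly_ring n)"
    by (rule monomial_span_ideal[OF cylinder_upset_meets])
  show "cring (mpoly_ring n)" by (rule mpoly_ring_cring)
  have "monom 0 \<in> carrier (mpoly_ring n)"
    unfolding mpoly_ring_carrier by (rule single_mem_monomial_span[OF zero_mem_exponents])
  moreover have "monom 0 \<notin> (monomial_span (meets n A) :: (_ \<Rightarrow>\<^sub>0 'k) set)"
    by (simp add: monomial_span_def meets_def)
  ultimately show "carrier (mpoly_ring n) \<noteq> (monomial_span (meets n A) :: (_ \<Rightarrow>\<^sub>0 'k) set)"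
    by blast
  fix f g :: "_ \<Rightarrow>\<^sub>0 'k"
  assume f: "f \<in> carrier (mpoly_ring n)" and g: "g \<in> carrier (mpoly_ring n)"
    and fg: "f \<otimes>\<^bsub>mpoly_ring n\<^esub> g \<in> monomial_span (meets n A)"
  show "f \<in> monomial_span (meets n A) \<or> g \<in> monomial_span (meets n A)"
  proof (rule disjCI)
    assume "g \<notin> monomial_span (meets n A)"
    with g obtain v where v: "v \<in> Poly_Mapping.keys g" "\<forall>a\<in>A. Poly_Mapping.lookup v a = 0"
      by (rule not_mem_span_meetsE)
    show "f \<in> monomial_span (meets n A)"
      using monomial_span_cancel[OF A cylinder_upset_meets _ _ v] f g fg
      by (simp add: mpoly_ring_carrier mult.commute)
  qed
qed

lemma diff_single_add:
  assumes "0 < Poly_Mapping.lookup t a"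
  shows "Poly_Mapping.single a 1 + (t - Poly_Mapping.single a 1) = (t :: nat \<Rightarrow>\<^sub>0 nat)"
  using assms by (intro poly_mapping_eqI) (auto simp: lookup_add lookup_minus lookup_single when_def)

lemma exponents_diff: "t \<in> exponents n \<Longrightarrow> t - u \<in> exponents n"
  by (auto simp: exponents_def in_keys_iff lookup_minus subset_iff)

lemma single_mem_exponents: "t \<in> exponents n \<Longrightarrow> 0 < Poly_Mapping.lookup t a \<Longrightarrow>
    Poly_Mapping.single a 1 \<in> exponents n"
  by (auto simp: exponents_def in_keys_iff subset_iff lookup_single when_def)

lemma monom_mem_carrier: "t \<in> exponents n \<Longrightarrow> monom t \<in> carrier (mpoly_ring n)"
  unfolding mpoly_ring_carrier by (rule single_mem_monomial_span)

text \<open>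
  A monomial is a product of variables; the induction on the total degree strips off one of them
  at a time. The degree is summed over all indices below \<open>n\<close>, so that the range does not change
  with \<open>t\<close>.
\<close>

lemma variable_in_prime:
  assumes P: "primeideal P (mpoly_ring n)"
    and "t \<in> exponents n" "(monom t :: _ \<Rightarrow>\<^sub>0 'k::field) \<in> P"
  obtains a where "0 < Poly_Mapping.lookup t a" "(monom (Poly_Mapping.single a 1) :: _ \<Rightarrow>\<^sub>0 'k) \<in> P"
proof -
  interpret P: primeideal P "mpoly_ring n" by fact
  have "\<exists>a. 0 < Poly_Mapping.lookup t a \<and> (monom (Poly_Mapping.single a 1) :: _ \<Rightarrow>\<^sub>0 'k) \<in> P"
    using assms(2,3)
  proof (induction "\<Sum>a<n. Poly_Mapping.lookup t a" arbitrary: t rule: less_induct)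
    case less
    show ?case
    proof (cases "t = 0")
      case True
      then have "\<one>\<^bsub>mpoly_ring n\<^esub> \<in> P" using less.prems by simp
      then show ?thesis using P.I_notcarr P.one_imp_carrier by auto
    next
      case False
      then obtain a where a: "0 < Poly_Mapping.lookup t a"
        by (metis gr0I poly_mapping_eqI lookup_zero)
      define u where "u = t - Poly_Mapping.single a 1"
      have tu: "t = Poly_Mapping.single a 1 + u" using diff_single_add[OF a] by (simp add: u_def)
      have "a < n" using a less.prems by (auto simp: exponents_def in_keys_iff subset_iff)
      have u: "u \<in> exponents n" unfolding u_def by (rule exponents_diff[OF less.prems(1)])
      have "(monom (Poly_Mapping.single a 1) :: _ \<Rightarrow>\<^sub>0 'k) \<in> P \<or> (monom u :: _ \<Rightarrow>\<^sub>0 'k) \<in> P"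
        using P.I_prime[OF monom_mem_carrier monom_mem_carrier, of "Poly_Mapping.single a 1" u]
          single_mem_exponents[OF less.prems(1) a] u less.prems(2)
        unfolding mpoly_ring_simps mult_single tu[symmetric] by simp
      then show ?thesis
      proof
        assume "(monom u :: _ \<Rightarrow>\<^sub>0 'k) \<in> P"
        moreover have "(\<Sum>b<n. Poly_Mapping.lookup u b) < (\<Sum>b<n. Poly_Mapping.lookup t b)"
          using \<open>a < n\<close> a
          by (intro sum_strict_mono_ex1) (auto simp: u_def lookup_minus intro!: bexI[of _ a])
        ultimately obtain b where "0 < Poly_Mapping.lookup u b"
          "(monom (Poly_Mapping.single b 1) :: _ \<Rightarrow>\<^sub>0 'k) \<in> P"
          using less.hyps[OF _ u] by blast
        then show ?thesis by (intro exI[of _ b]) (auto simp: tu lookup_add)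
      qed (use a in blast)
    qed
  qed
  with that show ?thesis by blast
qed

text \<open>
  \<open>A\<close> consists of the variables in the prime. They generate a prime ideal inside \<open>P\<close>, and it
  still contains every generator of the monomial ideal, since each of these is a monomial in \<open>P\<close>
  and so has a factor in \<open>A\<close>. Minimality of \<open>P\<close> gives equality.
\<close>

lemma minimal_prime_of_monomial_ideal:
  fixes P :: "((nat \<Rightarrow>\<^sub>0 nat) \<Rightarrow>\<^sub>0 'k::field) set"
  assumes E: "E \<subseteq> exponents n"
    and P: "P \<in> minimal_primes (mpoly_ring n) (Idl\<^bsub>mpoly_ring n\<^esub> (monom ` E))"
  obtains A where "finite A" "P = monomial_span (meets n A)"
proof -
  interpret cring "mpoly_ring n" by (rule mpoly_ring_cring)
  have prime: "primeideal P (mpoly_ring n)" and sub: "Idl\<^bsub>mpoly_ring n\<^esub> (monom ` E) \<subseteq> P"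
    using P unfolding minimal_primes_def by auto
  interpret P: primeideal P "mpoly_ring n" by (rule prime)
  define A where "A = {a. a < n \<and> (monom (Poly_Mapping.single a 1) :: _ \<Rightarrow>\<^sub>0 'k) \<in> P}"
  have A: "finite A" by (simp add: A_def)
  have gens: "monom ` E \<subseteq> carrier (mpoly_ring n)" using E by (auto intro: monom_mem_carrier)
  have "monomial_span (meets n A) \<subseteq> P"
  proof (rule monomial_span_subset_ideal[OF P.is_ideal])
    fix t assume "t \<in> meets n A"
    then obtain a where t: "t \<in> exponents n" and a: "a \<in> A" "0 < Poly_Mapping.lookup t a"
      by (auto simp: meets_def)
    have "monom (t - Poly_Mapping.single a 1) \<otimes>\<^bsub>mpoly_ring n\<^esub> monom (Poly_Mapping.single a 1) \<in> P"
      using a t by (intro P.I_l_closed monom_mem_carrier exponents_diff) (auto simp: A_def)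
    then show "monom t \<in> P"
      using diff_single_add[OF a(2)] by (simp add: mult_single add.commute)
  qed
  moreover have "Idl\<^bsub>mpoly_ring n\<^esub> (monom ` E) \<subseteq> (monomial_span (meets n A) :: (_ \<Rightarrow>\<^sub>0 'k) set)"
  proof (rule genideal_minimal[OF monomial_span_ideal[OF cylinder_upset_meets]])
    show "monom ` E \<subseteq> (monomial_span (meets n A) :: (_ \<Rightarrow>\<^sub>0 'k) set)"
    proof (rule image_subsetI)
      fix e assume e: "e \<in> E"
      then have "(monom e :: _ \<Rightarrow>\<^sub>0 'k) \<in> P" using genideal_self[OF gens] sub by blast
      then obtain a where a: "0 < Poly_Mapping.lookup e a"
        "(monom (Poly_Mapping.single a 1) :: _ \<Rightarrow>\<^sub>0 'k) \<in> P"
        using variable_in_prime[OF prime] e E by blast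
      moreover have "a < n" using a(1) e E by (auto simp: exponents_def in_keys_iff subset_iff)
      ultimately have "e \<in> meets n A" using e E by (auto simp: meets_def A_def)
      then show "(monom e :: _ \<Rightarrow>\<^sub>0 'k) \<in> monomial_span (meets n A)"
        by (rule single_mem_monomial_span)
    qed
  qed
  ultimately have "monomial_span (meets n A) = P"
    using minimal_primes_unique[OF P span_meets_prime[OF A]] by blast
  with A that show ?thesis by blast
qed

text \<open>
  The set \<open>T\<close> collects the exponents that are above some generator when only the coordinates in
  \<open>A\<close> are compared. Its span contains the ideal and is saturated; conversely, a monomial with
  exponent in \<open>T\<close> becomes a multiple of a generator after multiplication by a monomial free of
  the variables from \<open>A\<close>.
\<close>

lemma saturation_of_monomial_ideal:
  fixes P :: "((nat \<Rightarrow>\<^sub>0 nat) \<Rightarrow>\<^sub>0 'k::field) set"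
  assumes E: "E \<subseteq> exponents n" and A: "finite A" and P: "P = monomial_span (meets n A)"
    and I_def: "I = Idl\<^bsub>mpoly_ring n\<^esub> (monom ` E)"
  obtains T where "cylinder_upset n A T" "saturation (mpoly_ring n) P I = monomial_span T"
proof -
  interpret cring "mpoly_ring n" by (rule mpoly_ring_cring)
  interpret P: primeideal P "mpoly_ring n" unfolding P by (rule span_meets_prime[OF A])
  have gens: "monom ` E \<subseteq> carrier (mpoly_ring n)" using E by (auto intro: monom_mem_carrier)
  interpret I: ideal I "mpoly_ring n" unfolding I_def by (rule genideal_ideal[OF gens])
  define T where "T = {t \<in> exponents n. \<exists>e\<in>E. \<forall>a\<in>A. Poly_Mapping.lookup e a \<le> Poly_Mapping.lookup t a}"
  have T: "cylinder_upset n A T"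
    unfolding cylinder_upset_def T_def by (auto intro: order_trans)
  have "I \<subseteq> monomial_span T"
    unfolding I_def using E
    by (intro genideal_minimal[OF monomial_span_ideal[OF T]])
      (auto simp: T_def intro!: single_mem_monomial_span)
  have "saturation (mpoly_ring n) P I = monomial_span T"
  proof
    show "saturation (mpoly_ring n) P I \<subseteq> monomial_span T"
    proof
      fix f assume "f \<in> saturation (mpoly_ring n) P I"
      then obtain s where f: "f \<in> carrier (mpoly_ring n)"
        and s: "s \<in> carrier (mpoly_ring n)" "s \<notin> P" "s * f \<in> I"
        by (auto simp: saturation_def)
      obtain v where "v \<in> Poly_Mapping.keys s" "\<forall>a\<in>A. Poly_Mapping.lookup v a = 0"
        using s(1,2) unfolding P by (rule not_mem_span_meetsE)
      then show "f \<in> monomial_span T"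
        using monomial_span_cancel[OF A T] f s \<open>I \<subseteq> monomial_span T\<close>
        unfolding mpoly_ring_carrier by blast
    qed
    show "monomial_span T \<subseteq> saturation (mpoly_ring n) P I"
    proof (rule monomial_span_subset_ideal[OF P.saturation_ideal[OF I.is_ideal]])
      fix t assume "t \<in> T"
      then obtain e where e: "e \<in> E" and t: "t \<in> exponents n"
        and le: "\<And>a. a \<in> A \<Longrightarrow> Poly_Mapping.lookup e a \<le> Poly_Mapping.lookup t a"
        by (auto simp: T_def)
      \<comment> \<open>Subtraction of exponents is truncated, so \<open>s\<close> is what \<open>t\<close> lacks to be a multiple of \<open>e\<close>.\<close>
      define s where "s = e - t"
      have s: "s \<in> exponents n" unfolding s_def using E e by (blast intro: exponents_diff)
      have "s \<notin> meets n A" using le by (auto simp: meets_def s_def lookup_minus)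
      then have "monom s \<in> carrier (mpoly_ring n) - P"
        using monom_mem_carrier[OF s] unfolding P by (simp add: monomial_span_def)
      moreover have "monom (s + t - e) \<otimes>\<^bsub>mpoly_ring n\<^esub> monom e \<in> I"
      proof (rule I.I_l_closed)
        show "monom e \<in> I" unfolding I_def using genideal_self[OF gens] e by blast
      qed (intro monom_mem_carrier exponents_diff exponents_add s t)
      moreover have "(s + t - e) + e = s + t"
        by (rule poly_mapping_eqI) (simp add: s_def lookup_add lookup_minus)
      ultimately have "monom s \<in> carrier (mpoly_ring n) - P"
        "monom s \<otimes>\<^bsub>mpoly_ring n\<^esub> monom t \<in> I"
        by (simp_all add: mult_single)
      then show "monom t \<in> saturation (mpoly_ring n) P I"
        using monom_mem_carrier[OF t] unfolding saturation_def by blast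
    qed
  qed
  with T that show ?thesis by blast
qed

text \<open>
  The power of the saturation contains \<open>I\<^sup>k\<close> and is the span of a set of exponents that
  depends on the coordinates in \<open>A\<close> only, hence it is saturated and contains the saturation of
  \<open>I\<^sup>k\<close>.
\<close>

lemma saturation_power_of_monomial_ideal:
  fixes P :: "((nat \<Rightarrow>\<^sub>0 nat) \<Rightarrow>\<^sub>0 'k::field) set"
  assumes I: "monomial_ideal n I" and P: "P \<in> minimal_primes (mpoly_ring n) I"
  shows "saturation (mpoly_ring n) P (ideal_power (mpoly_ring n) I k)
    = ideal_power (mpoly_ring n) (saturation (mpoly_ring n) P I) k"
proof
  interpret cring "mpoly_ring n" by (rule mpoly_ring_cring)
  interpret P: primeideal P "mpoly_ring n" using P by (simp add: minimal_primes_def)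
  obtain E where E: "E \<subseteq> exponents n" "I = Idl\<^bsub>mpoly_ring n\<^esub> (monom ` E)"
    using I by (auto simp: monomial_ideal_def)
  interpret I: ideal I "mpoly_ring n"
    unfolding E(2) using E(1) by (intro genideal_ideal) (auto intro: monom_mem_carrier)
  obtain A where A: "finite A" "P = monomial_span (meets n A)"
    using minimal_prime_of_monomial_ideal[OF E(1)] P unfolding E(2) by blast
  obtain T where T: "cylinder_upset n A T" "saturation (mpoly_ring n) P I = monomial_span T"
    using saturation_of_monomial_ideal[OF E(1) A E(2)] by blast
  obtain U where U: "cylinder_upset n A U"
    "ideal_power (mpoly_ring n) (saturation (mpoly_ring n) P I) k = monomial_span U"
    using ideal_power_monomial_span[OF T(1)] unfolding T(2) by blast
  have "\<one>\<^bsub>mpoly_ring n\<^esub> \<in> carrier (mpoly_ring n) - P"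
    using P.I_notcarr P.one_imp_carrier one_closed by blast
  moreover have "\<one>\<^bsub>mpoly_ring n\<^esub> \<otimes>\<^bsub>mpoly_ring n\<^esub> f \<in> I" if "f \<in> I" for f
    using that by simp
  ultimately have "I \<subseteq> saturation (mpoly_ring n) P I"
    using I.Icarr unfolding saturation_def by blast
  then have sub: "ideal_power (mpoly_ring n) I k \<subseteq> monomial_span U"
    unfolding U(2)[symmetric] by (rule ideal_power_mono)
  show "saturation (mpoly_ring n) P (ideal_power (mpoly_ring n) I k)
    \<subseteq> ideal_power (mpoly_ring n) (saturation (mpoly_ring n) P I) k"
    unfolding U(2)
  proof
    fix f assume "f \<in> saturation (mpoly_ring n) P (ideal_power (mpoly_ring n) I k)"
    then obtain s where f: "f \<in> carrier (mpoly_ring n)"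
      and s: "s \<in> carrier (mpoly_ring n)" "s \<notin> P" "s * f \<in> ideal_power (mpoly_ring n) I k"
      by (auto simp: saturation_def)
    obtain v where "v \<in> Poly_Mapping.keys s" "\<forall>a\<in>A. Poly_Mapping.lookup v a = 0"
      using s(1,2) unfolding A(2) by (rule not_mem_span_meetsE)
    then show "f \<in> monomial_span U"
      using monomial_span_cancel[OF A(1) U(1)] f s sub
      unfolding mpoly_ring_carrier by blast
  qed
  show "ideal_power (mpoly_ring n) (saturation (mpoly_ring n) P I) k
    \<subseteq> saturation (mpoly_ring n) P (ideal_power (mpoly_ring n) I k)"
    by (rule P.power_saturation_subset[OF I.is_ideal])
qed

theorem lemma2:
  fixes n m r :: nat
    and R :: "((nat \<Rightarrow>\<^sub>0 nat) \<Rightarrow>\<^sub>0 'k::field) ring"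
    and I :: "((nat \<Rightarrow>\<^sub>0 nat) \<Rightarrow>\<^sub>0 'k) set"
    and Q :: "nat \<Rightarrow> ((nat \<Rightarrow>\<^sub>0 nat) \<Rightarrow>\<^sub>0 'k) set"
  assumes "R = mpoly_ring n"
    and "monomial_ideal n I"
    and "minimal_primary_decomposition R I Q m"
    and "r \<le> m"
    and "\<And>i. i \<in> {1..m} \<Longrightarrow> radical R (Q i) \<in> minimal_primes R I \<longleftrightarrow> i \<le> r"
  shows "\<forall>k\<ge>1. symbolic_power R I k = ideal_INT R {1..r} (\<lambda>i. ideal_power R (Q i) k)"
proof (intro allI impI)
  fix k :: nat
  interpret cring R unfolding assms(1) by (rule mpoly_ring_cring)
  interpret minimal_primary_decomp R I Q m by unfold_locales (rule assms(3))
  have minimal: "radical R (Q i) \<in> minimal_primes R I" and index: "i \<in> {1..m}" if "i \<in> {1..r}" for i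
    using that assms(4,5) by auto
  have "minimal_primes R I = (\<lambda>i. radical R (Q i)) ` {1..r}"
  proof (intro equalityI subsetI)
    fix P assume P: "P \<in> minimal_primes R I"
    then obtain i where i: "i \<in> {1..m}" "P = radical R (Q i)"
      by (rule minimal_prime_is_radical)
    with P assms(5) show "P \<in> (\<lambda>i. radical R (Q i)) ` {1..r}" by auto
  qed (use minimal in blast)
  moreover have "extend_contract_at R (radical R (Q i)) (ideal_power R I k) = ideal_power R (Q i) k"
    if i: "i \<in> {1..r}" for i
  proof -
    interpret P: primeideal "radical R (Q i)" R
      by (rule primaryideal.radical_primeideal[OF component_primary[OF index[OF i]]])
    have "ideal I R"
      using assms(2) unfolding monomial_ideal_def assms(1)
      by (auto intro!: cring.axioms(1)[OF mpoly_ring_cring, THEN ring.genideal_ideal] monom_mem_carrier)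
    then have "extend_contract_at R (radical R (Q i)) (ideal_power R I k)
        = saturation R (radical R (Q i)) (ideal_power R I k)"
      by (intro P.extend_contract_at_eq_saturation ideal_power_ideal)
    also have "\<dots> = ideal_power R (saturation R (radical R (Q i)) I) k"
      using saturation_power_of_monomial_ideal[OF assms(2)] minimal[OF i] unfolding assms(1) by blast
    also have "saturation R (radical R (Q i)) I = Q i"
      by (rule saturation_at_minimal_prime[OF index[OF i] minimal[OF i]])
    finally show ?thesis .
  qed
  ultimately show "symbolic_power R I k = ideal_INT R {1..r} (\<lambda>i. ideal_power R (Q i) k)"
    unfolding symbolic_power_def ideal_INT_def by simp
qed

end
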